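(* Set $q=e^{-R\hbar}$, $Q=(R\Lambda)^2$, and let $\boldsymbol{t}=\boldsymbol{t}(\boldsymbol{T},R)$ be the $R$-dependent transformation of $\boldsymbol{T}=(T_1,T_2,\ldots)$ to $\boldsymbol{t}=(t_1,t_2,\ldots)$ defined by $$t_j=\sum_{k=j}^\infty\binom{k}{j}\frac{(-1)^{k-j}T_k}{(-R\hbar)^k},\qquad j=1,2,\ldots.$$ Then, as $R\to0$, $Z(\boldsymbol{t})$ converges to $Z_{\mathrm{4D}}(\boldsymbol{T})$: $$\lim_{R\to0}Z(\boldsymbol{t}(\boldsymbol{T},R))=Z_{\mathrm{4D}}(\boldsymbol{T}).$$
   Context: $\mathcal{P}$ is the set of all partitions $\lambda=(\lambda_1\ge\lambda_2\ge\cdots\ge0)$ with finitely many nonzero parts, $|\lambda|=\sum_i\lambda_i$, and $\dim\lambda$ is the number of standard Young tableaux of shape $\lambda$. $s_\lambda(q^{-\rho})$ is the value of the Schur function $s_\lambda(x_1,x_2,\ldots)$ at $x_i=q^{i-1/2}$, $i=1,2,\ldots$. Define $$Z(\boldsymbol{t})=\sum_{\lambda\in\mathcal{P}}s_\lambda(q^{-\rho})^2Q^{|\lambda|}\exp\Big(\sum_{k=1}^\infty t_k\phi_k(\lambda)\Big),\qquad \phi_k(\lambda)=\sum_{i=1}^\infty\big(q^{k(\lambda_i-i+1)}-q^{k(-i+1)}\big),$$ $$Z_{\mathrm{4D}}(\boldsymbol{T})=\sum_{\lambda\in\mathcal{P}}\left(\frac{\dim\lambda}{|\lambda|!}\right)^2\left(\frac{\Lambda}{\hbar}\right)^{2|\lambda|}\exp\Big(\sum_{k=1}^\infty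 T_k\phi^{\mathrm{4D}}_k(\lambda)\Big),\qquad \phi^{\mathrm{4D}}_k(\lambda)=\sum_{i=1}^\infty\big((\lambda_i-i+1)^k-(-i+1)^k\big).$$ The sums over $i$ have finitely many nonzero terms. Here $R>0$, $\mathrm{Re}\,\hbar>0$ (so $|q|<1$), $q^{1/2}=e^{-R\hbar/2}$, and $R\to0^+$. After the substitutions both $Z(\boldsymbol{t}(\boldsymbol{T},R))$ and $Z_{\mathrm{4D}}(\boldsymbol{T})$ are regarded as formal power series in $\Lambda^2$ and $T_1,T_2,\ldots$ (in the exponent, the coefficient of each $T_k$ is a finite linear combination of $\phi_1(\lambda),\ldots,\phi_k(\lambda)$), and the limit is taken coefficientwise. *)

theory Defs
  imports "HOL-Analysis.Analysis" "HOL-Library.Multiset" "HOL-Library.FuncSet"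
begin

section \<open>Formal power series in arbitrarily many commuting variables\<close>

text \<open>
  A monomial in variables from \<^typ>\<open>'v\<close> is a finite multiset of variables, so a
  formal power series is an arbitrary function assigning a coefficient to each monomial.
\<close>

typedef ('v, 'a) mps = "UNIV :: ('v multiset \<Rightarrow> 'a) set"
  morphisms mps_coeff Abs_mps ..

lemma mps_coeff_Abs [simp]: "mps_coeff (Abs_mps f) = f"
  by (simp add: Abs_mps_inverse)

lemma mps_eqI: "(\<And>M. mps_coeff f M = mps_coeff g M) \<Longrightarrow> f = g"
  by (simp add: mps_coeff_inject[symmetric] fun_eq_iff)

lemma finite_submultisets: "finite {A. A \<subseteq># M}"
proof (induction M)
  case empty
  then show ?case by simp
next
  case (add x M)
  have "{A. A \<subseteq># add_mset x M} \<subseteq> {A. A \<subseteq># M} \<union> add_mset x ` {A. A \<subseteq># M}"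
  proof
    fix A assume "A \<in> {A. A \<subseteq># add_mset x M}"
    then have A: "A \<subseteq># add_mset x M" by simp
    show "A \<in> {A. A \<subseteq># M} \<union> add_mset x ` {A. A \<subseteq># M}"
    proof (cases "x \<in># A")
      case True
      then obtain B where "A = add_mset x B" by (meson multi_member_split)
      with A show ?thesis by auto
    next
      case False
      with A have "A \<subseteq># M"
        by (metis diff_single_trivial subset_eq_diff_conv add_mset_add_single)
      then show ?thesis by simp
    qed
  qed
  with add.IH show ?case by (meson finite_Un finite_imageI finite_subset)
qed

lemma double_diff_mset: "A \<subseteq># M \<Longrightarrow> M - (M - A) = A"
  by (metis add_diff_cancel_right' subset_mset.add_diff_inverse)

instantiation mps :: (type, comm_ring_1) comm_ring_1
begin

definition zero_mps :: "('a, 'b) mps" where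
  "0 = Abs_mps (\<lambda>M. 0)"

definition one_mps :: "('a, 'b) mps" where
  "1 = Abs_mps (\<lambda>M. if M = {#} then 1 else 0)"

definition plus_mps :: "('a, 'b) mps \<Rightarrow> ('a, 'b) mps \<Rightarrow> ('a, 'b) mps" where
  "f + g = Abs_mps (\<lambda>M. mps_coeff f M + mps_coeff g M)"

definition uminus_mps :: "('a, 'b) mps \<Rightarrow> ('a, 'b) mps" where
  "- f = Abs_mps (\<lambda>M. - mps_coeff f M)"

definition minus_mps :: "('a, 'b) mps \<Rightarrow> ('a, 'b) mps \<Rightarrow> ('a, 'b) mps" where
  "f - g = Abs_mps (\<lambda>M. mps_coeff f M - mps_coeff g M)"

definition times_mps :: "('a, 'b) mps \<Rightarrow> ('a, 'b) mps \<Rightarrow> ('a, 'b) mps" where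
  "f * g = Abs_mps (\<lambda>M. \<Sum>A | A \<subseteq># M. mps_coeff f A * mps_coeff g (M - A))"

instance
proof
  fix f g h :: "('a, 'b) mps"
  show "f + g + h = f + (g + h)" "f + g = g + f" "0 + f = f" "- f + f = 0" "f - g = f + - g"
    by (auto intro!: mps_eqI simp: plus_mps_def zero_mps_def uminus_mps_def minus_mps_def)
  show "(0 :: ('a, 'b) mps) \<noteq> 1"
  proof
    assume "(0 :: ('a, 'b) mps) = 1"
    then have "mps_coeff (0 :: ('a, 'b) mps) {#} = mps_coeff (1 :: ('a, 'b) mps) {#}" by simp
    then show False by (simp add: zero_mps_def one_mps_def)
  qed
  show "(f + g) * h = f * h + g * h"
    by (auto intro!: mps_eqI simp: plus_mps_def times_mps_def distrib_right sum.distrib)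
  show "1 * f = f"
  proof (rule mps_eqI)
    fix M
    have "mps_coeff (1 * f) M = (\<Sum>A | A \<subseteq># M. if A = {#} then mps_coeff f M else 0)"
      unfolding times_mps_def one_mps_def by (auto intro!: sum.cong)
    also have "\<dots> = mps_coeff f M"
      by (subst sum.delta) (auto simp: finite_submultisets)
    finally show "mps_coeff (1 * f) M = mps_coeff f M" .
  qed
  show "f * g = g * f"
  proof (rule mps_eqI)
    fix M
    show "mps_coeff (f * g) M = mps_coeff (g * f) M"
      unfolding times_mps_def mps_coeff_Abs
      by (rule sum.reindex_bij_witness[where i = "\<lambda>A. M - A" and j = "\<lambda>A. M - A"])
        (simp_all add: mult.commute double_diff_mset)
  qed
  show "f * g * h = f * (g * h)"
  proof (rule mps_eqI)
    fix M
    have "mps_coeff (f * g * h) M =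
        (\<Sum>(A, B) \<in> Sigma {A. A \<subseteq># M} (\<lambda>A. {B. B \<subseteq># A}).
           mps_coeff f B * mps_coeff g (A - B) * mps_coeff h (M - A))"
      unfolding times_mps_def mps_coeff_Abs sum_distrib_right
      by (rule sum.Sigma) (auto simp: finite_submultisets)
    also have "\<dots> = (\<Sum>(B, C) \<in> Sigma {B. B \<subseteq># M} (\<lambda>B. {C. C \<subseteq># M - B}).
           mps_coeff f B * (mps_coeff g C * mps_coeff h (M - B - C)))"
    proof -
      have r1: "B + (A - B) = A" if "B \<subseteq># A" for A B :: "'a multiset"
        using that by (rule subset_mset.add_diff_inverse)
      have r2: "B \<subseteq># M" if "B \<subseteq># A" "A \<subseteq># M" for A B
        using that by (rule subset_mset.order_trans)
      have r3: "A - B \<subseteq># M - B" if "A \<subseteq># M" for A B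
        unfolding subseteq_mset_def count_diff
        by (intro allI diff_le_mono mset_subset_eq_count that)
      have r4: "B + C \<subseteq># M" if "B \<subseteq># M" "C \<subseteq># M - B" for B C
        using that by (metis r1 mset_subset_eq_mono_add_left_cancel)
      have r5: "M - B - (A - B) = M - A" if "B \<subseteq># A" for A B
        using that by (metis r1 diff_diff_add)
      show ?thesis
        by (rule sum.reindex_bij_witness
          [where i = "\<lambda>(B, C). (B + C, B)" and j = "\<lambda>(A, B). (B, A - B)"])
          (clarsimp simp only: mem_Sigma_iff mem_Collect_eq split_beta fst_conv snd_conv
            r1 r3 r4 r5 mult.assoc add_diff_cancel_left' mset_subset_eq_add_left | fastforce intro: r2)+
    qed
    also have "\<dots> = mps_coeff (f * (g * h)) M"
      unfolding times_mps_def mps_coeff_Abs sum_distrib_left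
      by (rule sum.Sigma[symmetric]) (auto simp: finite_submultisets)
    finally show "mps_coeff (f * g * h) M = mps_coeff (f * (g * h)) M" .
  qed
qed

end

definition mps_const :: "'a::zero \<Rightarrow> ('v, 'a) mps" where
  "mps_const c = Abs_mps (\<lambda>M. if M = {#} then c else 0)"

definition mps_var :: "'v \<Rightarrow> ('v, 'a::zero_neq_one) mps" where
  "mps_var v = Abs_mps (\<lambda>M. if M = {#v#} then 1 else 0)"

lemma mps_coeff_times: "mps_coeff (f * g) M = (\<Sum>A | A \<subseteq># M. mps_coeff f A * mps_coeff g (M - A))"
  by (simp add: times_mps_def)

lemma mps_coeff_const_times [simp]: "mps_coeff (mps_const c * f) M = c * mps_coeff f M"
proof -
  have "mps_coeff (mps_const c * f) M = (\<Sum>A | A \<subseteq># M. if A = {#} then c * mps_coeff f M else 0)"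
    unfolding mps_coeff_times mps_const_def by (auto intro!: sum.cong)
  then show ?thesis
    by (simp add: sum.delta finite_submultisets)
qed

lemma mps_coeff_times_const [simp]: "mps_coeff (f * mps_const c) M = mps_coeff f M * c"
  by (metis mps_coeff_const_times mult.commute)

lemma mps_coeff_power_times_eq_0:
  assumes "mps_coeff f {#} = 0" "size M < n"
  shows "mps_coeff (f ^ n * g) M = 0"
  using assms(2)
proof (induction n arbitrary: M)
  case 0
  then show ?case by simp
next
  case (Suc n)
  have "mps_coeff f A * mps_coeff (f ^ n * g) (M - A) = 0" if "A \<subseteq># M" for A
  proof (cases "A = {#}")
    case True
    then show ?thesis using assms(1) by simp
  next
    case False
    then have "size A > 0" by (simp add: nonempty_has_size)
    with that Suc.prems have "size (M - A) < n"
      using size_mset_mono[OF that] by (simp add: size_Diff_submset)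
    then show ?thesis using Suc.IH by simp
  qed
  then show ?case
    by (simp add: mult.assoc mps_coeff_times[of f "f ^ n * g"])
qed

text \<open>
  Formal infinite sum of a locally finite family, i.e. one in which every monomial
  occurs in only finitely many members (for other families the value is meaningless).
\<close>

definition mps_sum :: "('i \<Rightarrow> ('v, 'a::comm_ring_1) mps) \<Rightarrow> 'i set \<Rightarrow> ('v, 'a) mps" where
  "mps_sum f I = Abs_mps (\<lambda>M. \<Sum>i | i \<in> I \<and> mps_coeff (f i) M \<noteq> 0. mps_coeff (f i) M)"

definition mps_locally_finite :: "('i \<Rightarrow> ('v, 'a::comm_ring_1) mps) \<Rightarrow> 'i set \<Rightarrow> bool" where
  "mps_locally_finite f I \<longleftrightarrow> (\<forall>M. finite {i \<in> I. mps_coeff (f i) M \<noteq> 0})"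

definition mps_exp :: "('v, complex) mps \<Rightarrow> ('v, complex) mps" where
  "mps_exp f = mps_sum (\<lambda>n. mps_const (1 / fact n) * f ^ n) UNIV"

lemma mps_locally_finite_exp:
  assumes "mps_coeff f {#} = 0"
  shows "mps_locally_finite (\<lambda>n. mps_const (1 / fact n :: complex) * f ^ n) UNIV"
  unfolding mps_locally_finite_def
proof
  fix M
  have "mps_coeff (f ^ n) M = 0" if "size M < n" for n
    using mps_coeff_power_times_eq_0[OF assms that, of 1] by simp
  then have "{n \<in> UNIV. mps_coeff (mps_const (1 / fact n :: complex) * f ^ n) M \<noteq> 0} \<subseteq> {..size M}"
    by (auto simp: not_less[symmetric])
  then show "finite {n \<in> UNIV. mps_coeff (mps_const (1 / fact n :: complex) * f ^ n) M \<noteq> 0}"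
    by (rule finite_subset) simp
qed


section \<open>Partitions, tableaux and Schur functions\<close>

text \<open>
  Indices are shifted to start at 0: \<open>l i\<close> is the part \<open>\<lambda>\<^sub>i\<^sub>+\<^sub>1\<close>, and the box in row
  \<open>i + 1\<close> and column \<open>j + 1\<close> is \<open>(i, j)\<close>.
\<close>

definition Partitions :: "(nat \<Rightarrow> nat) set" where
  "Partitions = {l. antimono l \<and> finite {i. l i \<noteq> 0}}"

definition psize :: "(nat \<Rightarrow> nat) \<Rightarrow> nat" where
  "psize l = (\<Sum>i | l i \<noteq> 0. l i)"

definition diagram :: "(nat \<Rightarrow> nat) \<Rightarrow> (nat \<times> nat) set" where
  "diagram l = {(i, j). j < l i}"

definition SYT :: "(nat \<Rightarrow> nat) \<Rightarrow> (nat \<times> nat \<Rightarrow> nat) set" where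
  "SYT l = {t \<in> diagram l \<rightarrow>\<^sub>E {1..psize l}.
     bij_betw t (diagram l) {1..psize l} \<and>
     (\<forall>i j j'. j < j' \<longrightarrow> (i, j') \<in> diagram l \<longrightarrow> t (i, j) < t (i, j')) \<and>
     (\<forall>i i' j. i < i' \<longrightarrow> (i', j) \<in> diagram l \<longrightarrow> t (i, j) < t (i', j))}"

definition SSYT :: "(nat \<Rightarrow> nat) \<Rightarrow> (nat \<times> nat \<Rightarrow> nat) set" where
  "SSYT l = {t \<in> diagram l \<rightarrow>\<^sub>E {1..}.
     (\<forall>i j j'. j < j' \<longrightarrow> (i, j') \<in> diagram l \<longrightarrow> t (i, j) \<le> t (i, j')) \<and>
     (\<forall>i i' j. i < i' \<longrightarrow> (i', j) \<in> diagram l \<longrightarrow> t (i, j) < t (i', j))}"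

definition dim_part :: "(nat \<Rightarrow> nat) \<Rightarrow> nat" where
  "dim_part l = card (SYT l)"

text \<open>
  Value of the Schur function at a sequence \<open>x 1, x 2, \<dots>\<close>.  The sum runs over infinitely many
  tableaux; it converges absolutely whenever \<open>x\<close> is absolutely summable.
\<close>

definition schur :: "(nat \<Rightarrow> nat) \<Rightarrow> (nat \<Rightarrow> complex) \<Rightarrow> complex" where
  "schur l x = (\<Sum>\<^sub>\<infinity>t\<in>SSYT l. \<Prod>b\<in>diagram l. x (t b))"


section \<open>The partition functions\<close>

text \<open>
  The argument \<open>p\<close> stands for the chosen square root of \<open>q\<close>, so \<open>q = p\<^sup>2\<close> and the
  Schur function is taken at \<open>x i = q\<^bsup>i - 1/2\<^esup>\<close>.
\<close>

definition schur_rho :: "complex \<Rightarrow> (nat \<Rightarrow> nat) \<Rightarrow> complex" where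
  "schur_rho p l = schur l (\<lambda>i. p powi (2 * int i - 1))"

definition phi :: "complex \<Rightarrow> nat \<Rightarrow> (nat \<Rightarrow> nat) \<Rightarrow> complex" where
  "phi q k l = (\<Sum>i. q powi (int k * (int (l i) - int i)) - q powi (int k * (- int i)))"

definition phi4D :: "nat \<Rightarrow> (nat \<Rightarrow> nat) \<Rightarrow> complex" where
  "phi4D k l = (\<Sum>i. of_int ((int (l i) - int i) ^ k - (- int i) ^ k))"

text \<open>
  The couplings \<open>t k\<close>, \<open>T k\<close> (with \<open>k \<ge> 1\<close>), \<open>Q\<close> and \<open>L2 = \<Lambda>\<^sup>2\<close> are themselves formal power
  series, so that substitutions can be carried out inside the ring of formal power series.
\<close>

definition Z ::
  "complex \<Rightarrow> ('v, complex) mps \<Rightarrow> (nat \<Rightarrow> ('v, complex) mps) \<Rightarrow> ('v, complex) mps" where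
  "Z p Q t = mps_sum (\<lambda>l.
     mps_const ((schur_rho p l)\<^sup>2) * Q ^ psize l *
     mps_exp (mps_sum (\<lambda>k. t k * mps_const (phi (p\<^sup>2) k l)) {1..})) Partitions"

definition Z4D ::
  "complex \<Rightarrow> ('v, complex) mps \<Rightarrow> (nat \<Rightarrow> ('v, complex) mps) \<Rightarrow> ('v, complex) mps" where
  "Z4D hbar L2 T = mps_sum (\<lambda>l.
     mps_const ((of_nat (dim_part l) / fact (psize l))\<^sup>2) *
     (mps_const (1 / hbar\<^sup>2) * L2) ^ psize l *
     mps_exp (mps_sum (\<lambda>k. T k * mps_const (phi4D k l)) {1..})) Partitions"

definition t_of_T ::
  "real \<Rightarrow> complex \<Rightarrow> (nat \<Rightarrow> ('v, complex) mps) \<Rightarrow> nat \<Rightarrow> ('v, complex) mps" where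
  "t_of_T R hbar T j = mps_sum (\<lambda>k.
     mps_const (of_nat (k choose j) * (-1) ^ (k - j) / (- (of_real R * hbar)) ^ k) * T k) {j..}"

datatype coupling = LambdaSq | Tvar nat

abbreviation L2var :: "(coupling, complex) mps" where
  "L2var \<equiv> mps_var LambdaSq"

abbreviation Tvars :: "nat \<Rightarrow> (coupling, complex) mps" where
  "Tvars k \<equiv> mps_var (Tvar k)"

text \<open>All formal infinite sums occurring above are locally finite.\<close>

lemma finite_partitions_le: "finite {l \<in> Partitions. psize l \<le> N}"
proof (rule finite_subset)
  show "{l \<in> Partitions. psize l \<le> N} \<subseteq>
      {l. \<forall>i. (i \<in> {..<N} \<longrightarrow> l i \<in> {..N}) \<and> (i \<notin> {..<N} \<longrightarrow> l i = 0)}"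
  proof (intro subsetI CollectI allI conjI impI)
    fix l i
    assume "l \<in> {l \<in> Partitions. psize l \<le> N}"
    then have l: "l \<in> Partitions" and N: "psize l \<le> N" by simp_all
    have fin: "finite {i. l i \<noteq> 0}" and anti: "antimono l"
      using l by (auto simp: Partitions_def)
    show "l i \<in> {..N}"
    proof (cases "l i = 0")
      case False
      then have "l i \<le> psize l"
        unfolding psize_def using fin by (intro member_le_sum) auto
      with N show ?thesis by simp
    qed simp
    assume i: "i \<notin> {..<N}"
    show "l i = 0"
    proof (rule ccontr)
      assume "l i \<noteq> 0"
      then have sub: "{..i} \<subseteq> {i. l i \<noteq> 0}"
        using antimonoD[OF anti] by fastforce
      have "Suc i \<le> (\<Sum>i | l i \<noteq> 0. 1)"
        using card_mono[OF fin sub] by simp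
      also have "\<dots> \<le> psize l"
        unfolding psize_def by (rule sum_mono) auto
      finally show False using N i by simp
    qed
  qed
  show "finite {l :: nat \<Rightarrow> nat. \<forall>i. (i \<in> {..<N} \<longrightarrow> l i \<in> {..N}) \<and> (i \<notin> {..<N} \<longrightarrow> l i = 0)}"
    by (rule finite_set_of_finite_funs) auto
qed

lemma mps_locally_finite_partitions:
  assumes "mps_coeff Q {#} = 0"
  shows "mps_locally_finite (\<lambda>l. mps_const (c l) * Q ^ psize l * g l) Partitions"
  unfolding mps_locally_finite_def
proof
  fix M
  have "{l \<in> Partitions. mps_coeff (mps_const (c l) * Q ^ psize l * g l) M \<noteq> 0}
      \<subseteq> {l \<in> Partitions. psize l \<le> size M}"
    using mps_coeff_power_times_eq_0[OF assms] by (force simp: mult.assoc not_less[symmetric])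
  then show "finite {l \<in> Partitions. mps_coeff (mps_const (c l) * Q ^ psize l * g l) M \<noteq> 0}"
    by (rule finite_subset) (rule finite_partitions_le)
qed

lemma mps_coeff_L2var_0: "mps_coeff (mps_const c * L2var) {#} = 0"
  by (simp add: mps_var_def)

lemma mps_coeff_Tvars: "mps_coeff (Tvars k) M = (if M = {#Tvar k#} then 1 else 0)"
  by (simp add: mps_var_def)

lemma mps_locally_finite_Tvars:
  "mps_locally_finite (\<lambda>k. mps_const (c k) * Tvars k) I"
  "mps_locally_finite (\<lambda>k. Tvars k * mps_const (c k)) I"
proof -
  have "finite {k. M = {#Tvar k#}}" for M
    by (rule finite_subset[of _ "the_inv Tvar ` set_mset M"])
      (auto intro!: image_eqI simp: the_inv_f_f inj_on_def)
  then show "mps_locally_finite (\<lambda>k. mps_const (c k) * Tvars k) I"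
    "mps_locally_finite (\<lambda>k. Tvars k * mps_const (c k)) I"
    unfolding mps_locally_finite_def
    by (auto simp: mps_coeff_Tvars intro: rev_finite_subset)
qed

lemma mps_coeff_t_of_T_nonzero:
  assumes "mps_coeff (t_of_T R hbar Tvars j) M \<noteq> 0"
  shows "\<exists>k\<ge>j. M = {#Tvar k#}"
proof -
  have "\<exists>k\<ge>j. mps_coeff (Tvars k) M \<noteq> 0"
  proof (rule ccontr)
    assume "\<not> ?thesis"
    then have "mps_coeff (t_of_T R hbar Tvars j) M = 0"
      unfolding t_of_T_def mps_sum_def mps_coeff_Abs by (intro sum.neutral) auto
    with assms show False by simp
  qed
  then show ?thesis
    by (auto simp: mps_coeff_Tvars split: if_splits)
qed

lemma mps_locally_finite_t_of_T:
  "mps_locally_finite (\<lambda>k. t_of_T R hbar Tvars k * mps_const (c k)) I"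
  unfolding mps_locally_finite_def
proof
  fix M
  show "finite {i \<in> I. mps_coeff (t_of_T R hbar Tvars i * mps_const (c i)) M \<noteq> 0}"
  proof (cases "\<exists>k. M = {#Tvar k#}")
    case True
    then obtain k where "M = {#Tvar k#}" ..
    then have "{i \<in> I. mps_coeff (t_of_T R hbar Tvars i * mps_const (c i)) M \<noteq> 0} \<subseteq> {..k}"
      using mps_coeff_t_of_T_nonzero by fastforce
    then show ?thesis by (rule finite_subset) simp
  next
    case False
    then have "mps_coeff (t_of_T R hbar Tvars i) M = 0" for i
      using mps_coeff_t_of_T_nonzero by blast
    then show ?thesis by simp
  qed
qed

lemma mps_coeff_exponent_0:
  "mps_coeff (mps_sum (\<lambda>k. t_of_T R hbar Tvars k * mps_const (c k)) I) {#} = 0"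
  "mps_coeff (mps_sum (\<lambda>k. Tvars k * mps_const (c k)) I) {#} = 0"
proof -
  have "mps_coeff (t_of_T R hbar Tvars k) {#} = 0" for k
    using mps_coeff_t_of_T_nonzero[of R hbar k "{#}"] by auto
  then show "mps_coeff (mps_sum (\<lambda>k. t_of_T R hbar Tvars k * mps_const (c k)) I) {#} = 0"
    by (simp add: mps_sum_def)
  show "mps_coeff (mps_sum (\<lambda>k. Tvars k * mps_const (c k)) I) {#} = 0"
    by (simp add: mps_sum_def mps_coeff_Tvars)
qed

end

theory Submission
  imports Defs
begin

text \<open>
  A semistandard tableau without repeated entries is a set of \<open>n = |\<lambda>|\<close> entries together with a
  standard tableau, and these account for \<open>dim \<lambda> / n!\<close> times the \<open>n\<close>-th power of
  \<open>\<Sum>\<^sub>i q\<^bsup>i - 1/2\<^esup> \<approx> 1 / (R h)\<close>, up to terms with repeated entries.  Two coinciding entries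
  cost a factor \<open>R\<close>, so all those terms are negligible and \<open>R\<^sup>n s\<^sub>\<lambda>(q\<^bsup>-\<rho>\<^esup>)\<close> tends to
  \<open>dim \<lambda> / (n! h\<^sup>n)\<close>.  By the binomial theorem the transformation from \<open>T\<close> to \<open>t\<close> makes the
  coefficient of \<open>T\<^sub>k\<close> in the exponent a difference of \<open>k\<close>-th powers of
  \<open>(q\<^bsup>a\<^esup> - 1) / (- R h)\<close>, which tends to \<open>a\<close> (with \<open>h\<close> for \<open>hbar\<close>).
\<close>

section \<open>Weighted sums over labellings of a finite set\<close>

lemma abs_summable_prod_PiE:
  fixes f :: "'a \<Rightarrow> nat \<Rightarrow> complex"
  assumes "finite D" "\<And>b. b \<in> D \<Longrightarrow> (\<lambda>i. norm (f b i)) summable_on B"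
  shows "(\<lambda>t. norm (\<Prod>b\<in>D. f b (t b))) summable_on (D \<rightarrow>\<^sub>E B)"
  using abs_summable_on_prod_PiE[of D "\<lambda>_. B" f] assms by (simp add: abs_summable_equivalent)

lemma has_sum_sum:
  fixes f :: "'i \<Rightarrow> 'a \<Rightarrow> 'b::topological_comm_monoid_add"
  assumes "finite I" "\<And>i. i \<in> I \<Longrightarrow> (f i has_sum s i) A"
  shows "((\<lambda>x. \<Sum>i\<in>I. f i x) has_sum (\<Sum>i\<in>I. s i)) A"
  using assms by (induction I rule: finite_induct) (auto intro: has_sum_add)

text \<open>An injective labelling factors uniquely as a bijection onto \<open>{1..card D}\<close>,
  its order pattern, followed by the increasing enumeration of its image \<open>A\<close>. Its
  weight depends only on \<open>A\<close>, and by \<open>UV\<close> its membership in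
  \<open>U\<close> depends only on the pattern. The sum over \<open>A\<close> is the elementary
  symmetric function of degree \<open>card D\<close>.\<close>

lemma infsum_injective_labellings:
  fixes x :: "nat \<Rightarrow> complex" and D :: "'a set"
  assumes D: "finite D" and x: "(\<lambda>i. norm (x i)) summable_on {1..}"
  assumes U: "U \<subseteq> {t \<in> D \<rightarrow>\<^sub>E {1..}. inj_on t D}"
    and V: "V \<subseteq> {s \<in> D \<rightarrow>\<^sub>E {1..card D}. bij_betw s D {1..card D}}"
    and UV: "\<And>s e. s \<in> D \<rightarrow>\<^sub>E {1..card D} \<Longrightarrow> bij_betw s D {1..card D} \<Longrightarrow>
      strict_mono_on {1..card D} e \<Longrightarrow> e ` {1..card D} \<subseteq> {1..} \<Longrightarrow>
      restrict (e \<circ> s) D \<in> U \<longleftrightarrow> s \<in> V"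
  shows "(\<Sum>\<^sub>\<infinity>t\<in>U. \<Prod>b\<in>D. x (t b)) =
    of_nat (card V) * (\<Sum>\<^sub>\<infinity>A | A \<subseteq> {1..} \<and> finite A \<and> card A = card D. prod x A)"
proof -
  define n where "n = card D"
  define S where "S = {A :: nat set. A \<subseteq> {1..} \<and> finite A \<and> card A = n}"
  \<comment> \<open>\<open>enumerate\<close> counts from 0 while patterns take values from 1, hence
    the shift.\<close>
  define e where "e A k = enumerate A (k - 1)" for A :: "nat set" and k
  have e_mono: "strict_mono_on {1..n} (e A)" if "A \<in> S" for A
    using that unfolding e_def S_def strict_mono_on_def
    by (auto intro!: finite_enumerate_mono)
  have e_bij: "bij_betw (e A) {1..n} A" if A: "A \<in> S" for A
  proof -
    have "bij_betw (\<lambda>k. k - 1) {1..n} {..<n}"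
      by (rule bij_betw_byWitness[where f' = Suc]) auto
    moreover have "bij_betw (enumerate A) {..<n} A"
      using A finite_bij_enumerate[of A] by (auto simp: S_def)
    ultimately have "bij_betw (enumerate A \<circ> (\<lambda>k. k - 1)) {1..n} A"
      by (rule bij_betw_trans)
    then show ?thesis
      by (simp add: e_def[abs_def] o_def)
  qed
  \<comment> \<open>\<open>i\<close> and \<open>j\<close> are the two directions of the bijection
    between \<open>V \<times> S\<close> and \<open>U\<close>: compose a pattern with an enumeration,
    or read off pattern and image.\<close>
  define i where "i = (\<lambda>(s, A). restrict (e A \<circ> s) D)"
  define j where "j t = (restrict (inv_into {1..n} (e (t ` D)) \<circ> t) D, t ` D)" for t :: "'a \<Rightarrow> nat"
  have imS: "t ` D \<in> S" if "t \<in> U" for t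
    using that U D by (auto simp: S_def n_def card_image)
  have bij_j: "bij_betw (fst (j t)) D {1..n}" "fst (j t) \<in> D \<rightarrow>\<^sub>E {1..n}" if t: "t \<in> U" for t
  proof -
    have "bij_betw t D (t ` D)"
      using t U by (auto simp: bij_betw_def)
    moreover have "bij_betw (inv_into {1..n} (e (t ` D))) (t ` D) {1..n}"
      using bij_betw_inv_into[OF e_bij[OF imS[OF t]]] .
    ultimately have "bij_betw (inv_into {1..n} (e (t ` D)) \<circ> t) D {1..n}"
      by (rule bij_betw_trans)
    then show *: "bij_betw (fst (j t)) D {1..n}"
      unfolding j_def fst_conv by (rule bij_betw_cong[THEN iffD1, rotated]) auto
    show "fst (j t) \<in> D \<rightarrow>\<^sub>E {1..n}"
      using bij_betw_imp_funcset[OF *] by (simp add: j_def PiE_def)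
  qed
  have ij: "i (j t) = t" if t: "t \<in> U" for t
  proof
    fix b
    show "i (j t) b = t b"
    proof (cases "b \<in> D")
      case True
      then have "t b \<in> e (t ` D) ` {1..n}"
        using bij_betw_imp_surj_on[OF e_bij[OF imS[OF t]]] by auto
      then show ?thesis
        using True by (simp add: i_def j_def f_inv_into_f)
    next
      case False
      then show ?thesis
        using t U by (auto simp: i_def split_beta PiE_def extensional_def)
    qed
  qed
  have jV: "j t \<in> V \<times> S" if t: "t \<in> U" for t
  proof -
    have "e (t ` D) ` {1..n} = t ` D"
      using e_bij[OF imS[OF t]] by (simp add: bij_betw_def)
    also have "\<dots> \<subseteq> {1..}"
      using t U by auto
    finally have "restrict (e (t ` D) \<circ> fst (j t)) D \<in> U \<longleftrightarrow> fst (j t) \<in> V"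
      using bij_j[OF t] e_mono[OF imS[OF t]] by (intro UV) (auto simp: n_def)
    moreover have "restrict (e (t ` D) \<circ> fst (j t)) D = t"
      using ij[OF t] by (simp add: i_def j_def)
    ultimately show ?thesis
      using t imS[OF t] by (auto simp: j_def)
  qed
  have im_i: "i (s, A) ` D = A" if "s \<in> V" "A \<in> S" for s A
  proof -
    have "i (s, A) ` D = e A ` (s ` D)"
      by (auto simp: i_def)
    also have "s ` D = {1..n}"
      using that V by (auto simp: bij_betw_def n_def)
    finally show ?thesis
      using e_bij[OF that(2)] by (simp add: bij_betw_def)
  qed
  have ji: "j (i y) = y" and iU: "i y \<in> U" if y: "y \<in> V \<times> S" for y
  proof -
    obtain s A where sA: "y = (s, A)" "s \<in> V" "A \<in> S"
      using y by auto
    have s: "s \<in> D \<rightarrow>\<^sub>E {1..n}" "bij_betw s D {1..n}"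
      using sA V by (auto simp: n_def)
    have "restrict (inv_into {1..n} (e A) \<circ> i (s, A)) D b = s b" for b
    proof (cases "b \<in> D")
      case True
      then have "s b \<in> {1..n}"
        using s by auto
      then show ?thesis
        using True e_bij[OF sA(3)] by (simp add: i_def bij_betw_def inv_into_f_f)
    next
      case False
      then show ?thesis
        using s by (auto simp: PiE_def extensional_def)
    qed
    then show "j (i y) = y"
      by (simp add: j_def im_i sA fun_eq_iff)
    have "e A ` {1..n} \<subseteq> {1..}"
      using e_bij[OF sA(3)] sA(3) by (auto simp: bij_betw_def S_def)
    then show "i y \<in> U"
      using UV[of s "e A"] s e_mono[OF sA(3)] sA by (simp add: i_def n_def)
  qed
  have w: "(case j t of (s, A) \<Rightarrow> prod x A) = (\<Prod>b\<in>D. x (t b))" if "t \<in> U" for t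
    using that U by (auto simp: j_def prod.reindex)
  have "finite V"
    by (rule finite_subset[OF V]) (auto intro!: finite_PiE finite_subset[OF _ finite_PiE[of D "\<lambda>_. {1..card D}"]] D)
  have "(\<lambda>t. \<Prod>b\<in>D. x (t b)) summable_on (D \<rightarrow>\<^sub>E {1..})"
    using abs_summable_summable[OF abs_summable_prod_PiE[of D "\<lambda>_. x", OF D x]] by simp
  then have "(\<lambda>t. \<Prod>b\<in>D. x (t b)) summable_on U"
    by (rule summable_on_subset_banach) (use U in auto)
  \<comment> \<open>Summability is carried over to \<open>V \<times> S\<close> first, since
    splitting the sum over a product into an iterated one requires it.\<close>
  also have "?this \<longleftrightarrow> (\<lambda>(s, A). prod x A) summable_on (V \<times> S)"
    by (rule summable_on_reindex_bij_witness[of _ i j]) (use ij jV ji iU w in auto)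
  finally have summ: "(\<lambda>(s, A). prod x A) summable_on (V \<times> S)" .
  have "(\<Sum>\<^sub>\<infinity>t\<in>U. \<Prod>b\<in>D. x (t b)) = infsum (\<lambda>(s, A). prod x A) (V \<times> S)"
    by (rule infsum_reindex_bij_witness[of _ i j]) (use ij jV ji iU w in auto)
  also have "\<dots> = (\<Sum>\<^sub>\<infinity>s\<in>V. \<Sum>\<^sub>\<infinity>A\<in>S. prod x A)"
    using infsum_Sigma_banach[OF summ] by simp
  also have "\<dots> = of_nat (card V) * (\<Sum>\<^sub>\<infinity>A\<in>S. prod x A)"
    using \<open>finite V\<close> by (simp add: infsum_finite)
  finally show ?thesis
    by (simp add: S_def n_def)
qed

lemma card_bijective_labellings:
  assumes "finite D"
  shows "card {s \<in> D \<rightarrow>\<^sub>E {1..card D}. bij_betw s D {1..card D}} = fact (card D)"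
proof -
  have "{s \<in> D \<rightarrow>\<^sub>E {1..card D}. bij_betw s D {1..card D}} =
      {s \<in> D \<rightarrow>\<^sub>E {1..card D}. inj_on s D}"
  proof (intro Collect_cong conj_cong refl iffI)
    fix s assume s: "s \<in> D \<rightarrow>\<^sub>E {1..card D}" "inj_on s D"
    then have "s ` D = {1..card D}"
      by (intro card_subset_eq) (auto simp: card_image)
    with s show "bij_betw s D {1..card D}"
      by (simp add: bij_betw_def)
  qed (simp add: bij_betw_def)
  also have "card \<dots> = fact (card D)"
    using card_inj_on_subset_funcset[of D "{1..card D}" D] assms
    by (simp add: fact_prod_rev)
  finally show ?thesis .
qed

text \<open>Union bound over ordered pairs of distinct positions with equal labels. Fixing such a
  pair leaves one squared factor and \<open>card D - 2\<close> free ones. For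
  \<open>card D < 2\<close> there is no pair and the prefactor is 0, so the truncated subtraction
  does no harm.\<close>

lemma norm_infsum_noninjective_labellings:
  fixes x :: "nat \<Rightarrow> complex" and D :: "'a set"
  assumes D: "finite D" and x: "(\<lambda>i. norm (x i)) summable_on {1..}"
    and U: "U \<subseteq> {t \<in> D \<rightarrow>\<^sub>E {1..}. \<not> inj_on t D}"
  shows "norm (\<Sum>\<^sub>\<infinity>t\<in>U. \<Prod>b\<in>D. x (t b)) \<le>
    real (card D * (card D - 1)) * (\<Sum>\<^sub>\<infinity>i\<in>{1..}. (norm (x i))\<^sup>2) * (\<Sum>\<^sub>\<infinity>i\<in>{1..}. norm (x i)) ^ (card D - 2)"
proof -
  define F where "F = D \<rightarrow>\<^sub>E {1::nat..}"
  define w where "w t = (\<Prod>b\<in>D. norm (x (t b)))" for t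
  define P where "P = {(b, c) \<in> D \<times> D. b \<noteq> c}"
  define p1 where "p1 = (\<Sum>\<^sub>\<infinity>i\<in>{1..}. norm (x i))"
  define p2 where "p2 = (\<Sum>\<^sub>\<infinity>i\<in>{1..}. (norm (x i))\<^sup>2)"
  have finP: "finite P"
    unfolding P_def by (rule finite_subset[of _ "D \<times> D"]) (use D in auto)
  have cardP: "card P = card D * (card D - 1)"
  proof -
    have "P = Sigma D (\<lambda>b. D - {b})"
      by (auto simp: P_def)
    then show ?thesis
      using D by simp
  qed
  have w0: "w t \<ge> 0" for t
    by (simp add: w_def prod_nonneg)
  have absw: "(\<lambda>t. norm (\<Prod>b\<in>D. x (t b))) summable_on F"
    unfolding F_def using abs_summable_prod_PiE[of D "\<lambda>_. x", OF D x] by simp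
  have wF: "w summable_on F"
    using absw by (simp add: w_def[abs_def] prod_norm)
  have wsub: "w summable_on G" if "G \<subseteq> F" for G
    using summable_on_subset_banach[OF wF that] .
  \<comment> \<open>Each \<open>norm (x i)\<close> is at most the whole sum \<open>p1\<close>, so
    the squares are dominated by \<open>p1 * norm (x i)\<close>.\<close>
  have x2: "(\<lambda>i. norm ((norm (x i))\<^sup>2)) summable_on {1..}"
  proof (rule Infinite_Sum.abs_summable_on_comparison_test')
    show "(\<lambda>i. p1 * norm (x i)) summable_on {1..}"
      using x by (rule summable_on_cmult_right)
    fix i :: nat assume "i \<in> {1..}"
    then have "norm (x i) \<le> p1"
      using finite_sum_le_infsum[OF x, of "{i}"] by (simp add: p1_def)
    then show "norm ((norm (x i))\<^sup>2) \<le> p1 * norm (x i)"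
      by (simp add: power2_eq_square mult_right_mono)
  qed
  have pair: "infsum w {t \<in> F. t b = t c} = p2 * p1 ^ (card D - 2)" if "(b, c) \<in> P" for b c
  proof -
    have bc: "b \<in> D" "c \<in> D" "b \<noteq> c"
      using that by (auto simp: P_def)
    define E where "E = D - {c}"
    \<comment> \<open>The label of \<open>c\<close> repeats that of \<open>b\<close>, so
      \<open>c\<close> is deleted and \<open>b\<close> carries the square; the sum over labellings
      of \<open>E\<close> then factors position by position.\<close>
    define f where "f a i = (if a = b then (norm (x i))\<^sup>2 else norm (x i))" for a i
    have E: "finite E" "b \<in> E" "c \<notin> E" "D = insert c E"
      using bc D by (auto simp: E_def)
    have f_b: "f b = (\<lambda>i. (norm (x i))\<^sup>2)" and f_other: "a \<noteq> b \<Longrightarrow> f a = (\<lambda>i. norm (x i))" for a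
      by (auto simp: f_def)
    have "infsum w {t \<in> F. t b = t c} = (\<Sum>\<^sub>\<infinity>t\<in>E \<rightarrow>\<^sub>E {1..}. \<Prod>a\<in>E. f a (t a))"
    proof (rule infsum_reindex_bij_witness[of _ "\<lambda>t. t(c := t b)" "\<lambda>t. restrict t E"])
      fix t assume t: "t \<in> {t \<in> F. t b = t c}"
      show "(restrict t E)(c := restrict t E b) = t"
        using t E by (auto simp: F_def fun_eq_iff PiE_def extensional_def)
      show "restrict t E \<in> E \<rightarrow>\<^sub>E {1..}"
        using t E by (auto simp: F_def)
      have "(\<Prod>a\<in>E. f a (restrict t E a)) = (norm (x (t b)))\<^sup>2 * (\<Prod>a\<in>E - {b}. norm (x (t a)))"
        using E by (subst prod.remove[of E b]) (auto simp: f_def intro!: prod.cong)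
      also have "\<dots> = w t"
        using t E unfolding w_def E(4)
        by (subst prod.insert) (auto simp: prod.remove[of E b] power2_eq_square)
      finally show "(\<Prod>a\<in>E. f a (restrict t E a)) = w t" .
    next
      fix t assume t: "t \<in> E \<rightarrow>\<^sub>E {1::nat..}"
      show "restrict (t(c := t b)) E = t"
        using t E by (auto simp: fun_eq_iff PiE_def extensional_def)
      show "t(c := t b) \<in> {t \<in> F. t b = t c}"
        using t E by (auto simp: F_def PiE_def extensional_def Pi_def)
    qed
    also have "\<dots> = (\<Prod>a\<in>E. infsum (f a) {1..})"
    proof (rule infsum_prod_PiE_abs[OF E(1)])
      show "(\<lambda>i. norm (f a i)) summable_on {1..}" for a
        by (cases "a = b") (use x x2 in \<open>simp_all add: f_def\<close>)
    qed
    also have "\<dots> = p2 * (\<Prod>a\<in>E - {b}. p1)"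
      using E by (subst prod.remove[of E b]) (auto simp: f_b f_other p1_def p2_def intro!: prod.cong)
    also have "card (E - {b}) = card D - 2"
      using E by simp
    then have "(\<Prod>a\<in>E - {b}. p1) = p1 ^ (card D - 2)"
      by simp
    finally show ?thesis .
  qed
  have pairsum: "(\<lambda>t. if t b = t c then w t else 0) summable_on F" for b c
    using wsub[of "{t \<in> F. t b = t c}"]
    by (subst summable_on_cong_neutral[of "{t \<in> F. t b = t c}" _ w]) auto
  have total: "((\<lambda>t. \<Sum>(b, c)\<in>P. if t b = t c then w t else 0) has_sum
      (\<Sum>(b, c)\<in>P. \<Sum>\<^sub>\<infinity>t\<in>F. if t b = t c then w t else 0)) F"
    unfolding split_beta using finP pairsum by (intro has_sum_sum has_sum_infsum)
  have "norm (\<Sum>\<^sub>\<infinity>t\<in>U. \<Prod>b\<in>D. x (t b)) \<le> infsum w U"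
    using norm_infsum_bound[of "\<lambda>t. \<Prod>b\<in>D. x (t b)" U] summable_on_subset_banach[OF absw, of U] U
    by (force simp: w_def[abs_def] prod_norm F_def)
  \<comment> \<open>A labelling in \<open>U\<close> has at least one coinciding pair, so its weight
    occurs at least once in the sum over \<open>P\<close>; the other terms are nonnegative.\<close>
  also have "\<dots> \<le> (\<Sum>\<^sub>\<infinity>t\<in>F. \<Sum>(b, c)\<in>P. if t b = t c then w t else 0)"
  proof (rule infsum_mono_neutral)
    show "w summable_on U"
      using U by (intro wsub) (auto simp: F_def)
    show "(\<lambda>t. \<Sum>(b, c)\<in>P. if t b = t c then w t else 0) summable_on F"
      using total by (rule has_sum_imp_summable)
    fix t
    { assume "t \<in> U \<inter> F"
      then obtain b c where bc: "(b, c) \<in> P" "t b = t c"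
        using U by (auto simp: inj_on_def P_def)
      have "(case (b, c) of (b, c) \<Rightarrow> if t b = t c then w t else 0) \<le>
          (\<Sum>(b, c)\<in>P. if t b = t c then w t else 0)"
      proof (rule member_le_sum)
        show "0 \<le> (case y of (b, c) \<Rightarrow> if t b = t c then w t else 0)" for y
          by (cases y) (simp add: w0)
      qed (use bc finP in auto)
      then show "w t \<le> (\<Sum>(b, c)\<in>P. if t b = t c then w t else 0)"
        using bc by simp }
    show "w t \<le> 0" if "t \<in> U - F"
      using that U by (auto simp: F_def)
    show "0 \<le> (\<Sum>(b, c)\<in>P. if t b = t c then w t else 0)"
      by (intro sum_nonneg) (auto simp: w0)
  qed
  also have "\<dots> = (\<Sum>(b, c)\<in>P. \<Sum>\<^sub>\<infinity>t\<in>F. if t b = t c then w t else 0)"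
    using total by (rule infsumI)
  also have "\<dots> = (\<Sum>(b, c)\<in>P. infsum w {t \<in> F. t b = t c})"
  proof -
    have "(\<Sum>\<^sub>\<infinity>t\<in>F. if t b = t c then w t else 0) = infsum w {t \<in> F. t b = t c}" for b c
      by (rule infsum_cong_neutral) auto
    then show ?thesis
      by simp
  qed
  also have "\<dots> = real (card P) * (p2 * p1 ^ (card D - 2))"
    using pair by (subst sum.cong[OF refl, of P _ "\<lambda>_. p2 * p1 ^ (card D - 2)"]) auto
  finally show ?thesis
    by (simp only: p1_def p2_def mult.assoc cardP)
qed

section \<open>Comparing semistandard and standard tableaux\<close>

lemma diagram_facts:
  assumes "l \<in> Partitions"
  shows finite_diagram: "finite (diagram l)" and card_diagram: "card (diagram l) = psize l"
proof -
  have *: "diagram l = Sigma {i. l i \<noteq> 0} (\<lambda>i. {..<l i})"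
    by (auto simp: diagram_def)
  have fin: "finite {i. l i \<noteq> 0}"
    using assms by (simp add: Partitions_def)
  show "finite (diagram l)" "card (diagram l) = psize l"
    unfolding * psize_def using fin by simp_all
qed

text \<open>A strictly increasing relabelling preserves every comparison of entries, and with
  distinct entries the weak row condition is the same as the strict one. This supplies the
  hypothesis \<open>UV\<close> of \<open>infsum_injective_labellings\<close> for tableaux.\<close>

lemma compose_SSYT_iff:
  assumes l: "l \<in> Partitions"
    and s: "s \<in> diagram l \<rightarrow>\<^sub>E {1..psize l}" "bij_betw s (diagram l) {1..psize l}"
    and e: "strict_mono_on {1..psize l} e" "e ` {1..psize l} \<subseteq> {1..}"
  shows "restrict (e \<circ> s) (diagram l) \<in> SSYT l \<longleftrightarrow> s \<in> SYT l"
proof -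
  define D where "D = diagram l"
  \<comment> \<open>\<open>restrict\<close> gives meaningful values only inside \<open>D\<close>, so
    the smaller box of each compared pair must also lie in \<open>D\<close>: diagrams are closed to
    the left and upwards.\<close>
  have left: "(i, j) \<in> D" if "j < j'" "(i, j') \<in> D" for i j j'
    using that by (auto simp: diagram_def D_def)
  have up: "(i, j) \<in> D" if "i < i'" "(i', j) \<in> D" for i i' j
  proof -
    have "l i' \<le> l i"
      using l that(1) antimonoD[of l i i'] by (simp add: Partitions_def)
    then show ?thesis
      using that by (auto simp: diagram_def D_def)
  qed
  have sD: "s b \<in> {1..psize l}" if "b \<in> D" for b
    using s(1) that by (auto simp: D_def)
  have e_less: "e (s b) < e (s c) \<longleftrightarrow> s b < s c" if "b \<in> D" "c \<in> D" for b c
    using strict_mono_on_less[OF e(1) sD sD] that by simp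
  have e_le: "e (s b) \<le> e (s c) \<longleftrightarrow> s b < s c" if "b \<in> D" "c \<in> D" "b \<noteq> c" for b c
  proof -
    have "s b \<noteq> s c"
      using s(2) that unfolding bij_betw_def D_def by (blast dest: inj_onD)
    then show ?thesis
      using e_less[OF that(1,2)] e_less[OF that(2,1)] by linarith
  qed
  have rows: "(\<forall>i j j'. j < j' \<longrightarrow> (i, j') \<in> D \<longrightarrow>
        restrict (e \<circ> s) D (i, j) \<le> restrict (e \<circ> s) D (i, j')) \<longleftrightarrow>
      (\<forall>i j j'. j < j' \<longrightarrow> (i, j') \<in> D \<longrightarrow> s (i, j) < s (i, j'))"
  proof (intro iff_allI imp_cong refl)
    fix i j j' assume *: "j < j'" "(i, j') \<in> D"
    then show "restrict (e \<circ> s) D (i, j) \<le> restrict (e \<circ> s) D (i, j') \<longleftrightarrow> s (i, j) < s (i, j')"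
      using left[OF *] by (simp add: e_le)
  qed
  have cols: "(\<forall>i i' j. i < i' \<longrightarrow> (i', j) \<in> D \<longrightarrow>
        restrict (e \<circ> s) D (i, j) < restrict (e \<circ> s) D (i', j)) \<longleftrightarrow>
      (\<forall>i i' j. i < i' \<longrightarrow> (i', j) \<in> D \<longrightarrow> s (i, j) < s (i', j))"
  proof (intro iff_allI imp_cong refl)
    fix i i' j assume *: "i < i'" "(i', j) \<in> D"
    then show "restrict (e \<circ> s) D (i, j) < restrict (e \<circ> s) D (i', j) \<longleftrightarrow> s (i, j) < s (i', j)"
      using up[OF *] by (simp add: e_less)
  qed
  have "restrict (e \<circ> s) D \<in> D \<rightarrow>\<^sub>E {1..}"
    unfolding restrict_PiE
  proof
    fix b assume "b \<in> D"
    then have "e (s b) \<in> e ` {1..psize l}"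
      using sD by blast
    then show "(e \<circ> s) b \<in> {1..}"
      using subsetD[OF e(2)] by (simp only: o_apply)
  qed
  moreover have "s \<in> D \<rightarrow>\<^sub>E {1..psize l}" "bij_betw s D {1..psize l}"
    using s unfolding D_def by blast+
  ultimately show ?thesis
    unfolding SSYT_def SYT_def D_def[symmetric] mem_Collect_eq rows cols by blast
qed

text \<open>The Schur function sums over \<open>SSYT l\<close>, the power of the power sum over all
  labellings. Their injective parts are \<open>d\<close> and \<open>fact n\<close> times the same
  elementary symmetric function \<open>E\<close>. Eliminating \<open>E\<close> leaves only the two
  noninjective parts, each bounded by \<open>B\<close>.\<close>

lemma schur_approximation:
  fixes x :: "nat \<Rightarrow> complex"
  assumes l: "l \<in> Partitions" and x: "(\<lambda>i. norm (x i)) summable_on {1..}"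
  shows "norm (schur l x - of_nat (dim_part l) / fact (psize l) * (\<Sum>\<^sub>\<infinity>i\<in>{1..}. x i) ^ psize l) \<le>
    (real (dim_part l) / fact (psize l) + 1) * (real (psize l * (psize l - 1)) *
      (\<Sum>\<^sub>\<infinity>i\<in>{1..}. (norm (x i))\<^sup>2) * (\<Sum>\<^sub>\<infinity>i\<in>{1..}. norm (x i)) ^ (psize l - 2))"
proof -
  define D where "D = diagram l"
  define n where "n = psize l"
  define d where "d = dim_part l"
  define F where "F = D \<rightarrow>\<^sub>E {1::nat..}"
  define I where "I = {t \<in> F. inj_on t D}"
  define w where "w t = (\<Prod>b\<in>D. x (t b))" for t
  define E where "E = (\<Sum>\<^sub>\<infinity>A | A \<subseteq> {1..} \<and> finite A \<and> card A = n. prod x A)"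
  define B where "B = real (n * (n - 1)) * (\<Sum>\<^sub>\<infinity>i\<in>{1..}. (norm (x i))\<^sup>2) *
    (\<Sum>\<^sub>\<infinity>i\<in>{1..}. norm (x i)) ^ (n - 2)"
  have D: "finite D" "card D = n"
    using diagram_facts[OF l] by (simp_all add: D_def n_def)
  have SF: "SSYT l \<subseteq> F"
    by (auto simp: SSYT_def F_def D_def)
  have "w summable_on F"
    unfolding F_def w_def
    using abs_summable_summable[OF abs_summable_prod_PiE[of D "\<lambda>_. x", OF D(1) x]] by simp
  then have summ: "w summable_on G" if "G \<subseteq> F" for G
    using summable_on_subset_banach that by blast
  have split: "infsum w G = infsum w (G \<inter> I) + infsum w (G - I)" if "G \<subseteq> F" for G
  proof -
    have "infsum w ((G \<inter> I) \<union> (G - I)) = infsum w (G \<inter> I) + infsum w (G - I)"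
      using that by (intro infsum_Un_disjoint summ) auto
    then show ?thesis
      by (simp only: Int_Diff_Un)
  qed
  have bound: "norm (infsum w (G - I)) \<le> B" if "G \<subseteq> F" for G
    using norm_infsum_noninjective_labellings[OF D(1) x, of "G - I"] that
    unfolding w_def[symmetric] B_def D(2) by (auto simp: I_def F_def)
  have comp: "restrict (e \<circ> s) D \<in> I"
    if s: "s \<in> D \<rightarrow>\<^sub>E {1..card D}" "bij_betw s D {1..card D}"
      and e: "strict_mono_on {1..card D} e" "e ` {1..card D} \<subseteq> {1..}"
    for s and e :: "nat \<Rightarrow> nat"
  proof -
    have "inj_on (e \<circ> s) D"
    proof (rule comp_inj_on)
      show "inj_on s D" "inj_on e (s ` D)"
        using s(2) strict_mono_on_imp_inj_on[OF e(1)] by (simp_all only: bij_betw_def)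
    qed
    moreover have "restrict (e \<circ> s) D \<in> F"
      unfolding F_def restrict_PiE
    proof
      fix b assume "b \<in> D"
      then have "e (s b) \<in> e ` {1..card D}"
        using s(1) by blast
      then show "(e \<circ> s) b \<in> {1..}"
        using subsetD[OF e(2)] by (simp only: o_apply)
    qed
    ultimately show ?thesis
      unfolding I_def by (simp only: mem_Collect_eq inj_on_restrict_eq)
  qed
  \<comment> \<open>For all injective labellings every order pattern is allowed, so the factor is
    the number of bijections, \<open>fact n\<close>.\<close>
  have "infsum w I = of_nat (card {s \<in> D \<rightarrow>\<^sub>E {1..n}. bij_betw s D {1..n}}) * E"
    unfolding w_def E_def D(2)[symmetric]
  proof (rule infsum_injective_labellings[OF D(1) x])
    fix s and e :: "nat \<Rightarrow> nat"
    assume s: "s \<in> D \<rightarrow>\<^sub>E {1..card D}" "bij_betw s D {1..card D}"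
      and e: "strict_mono_on {1..card D} e" "e ` {1..card D} \<subseteq> {1..}"
    show "restrict (e \<circ> s) D \<in> I \<longleftrightarrow> s \<in> {s \<in> D \<rightarrow>\<^sub>E {1..card D}. bij_betw s D {1..card D}}"
      using comp[OF s e] s by blast
  qed (auto simp: I_def F_def)
  then have all: "infsum w I = fact n * E"
    using card_bijective_labellings[OF D(1)] D(2) by simp
  have syt: "infsum w (SSYT l \<inter> I) = of_nat d * E"
    unfolding w_def E_def D(2)[symmetric] d_def dim_part_def
  proof (rule infsum_injective_labellings[OF D(1) x])
    show "SYT l \<subseteq> {s \<in> D \<rightarrow>\<^sub>E {1..card D}. bij_betw s D {1..card D}}"
      unfolding D(2) by (auto simp: SYT_def D_def n_def)
    fix s and e :: "nat \<Rightarrow> nat"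
    assume s: "s \<in> D \<rightarrow>\<^sub>E {1..card D}" "bij_betw s D {1..card D}"
      and e: "strict_mono_on {1..card D} e" "e ` {1..card D} \<subseteq> {1..}"
    show "restrict (e \<circ> s) D \<in> SSYT l \<inter> I \<longleftrightarrow> s \<in> SYT l"
      using compose_SSYT_iff[OF l, of s e, folded D_def n_def, folded D(2), OF s e] comp[OF s e]
      by blast
  qed (auto simp: I_def F_def)
  \<comment> \<open>Expanding the power chooses one index for each box, that is, an arbitrary
    labelling.\<close>
  have "(\<Sum>\<^sub>\<infinity>i\<in>{1..}. x i) ^ n = infsum w F"
    unfolding w_def F_def using infsum_prod_PiE_abs[of D "\<lambda>_. x" "\<lambda>_. {1..}"] D x by simp
  also have "\<dots> = fact n * E + infsum w (F - I)"
  proof -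
    have "F \<inter> I = I"
      by (auto simp: I_def)
    then show ?thesis
      using split[of F] all by simp
  qed
  finally have pow: "(\<Sum>\<^sub>\<infinity>i\<in>{1..}. x i) ^ n = fact n * E + infsum w (F - I)" .
  have "schur l x = of_nat d * E + infsum w (SSYT l - I)"
    using split[OF SF] syt by (simp add: schur_def w_def[abs_def] D_def)
  then have "schur l x - of_nat d / fact n * (\<Sum>\<^sub>\<infinity>i\<in>{1..}. x i) ^ n =
      infsum w (SSYT l - I) - of_nat d / fact n * infsum w (F - I)"
    unfolding pow by (simp add: field_simps)
  also have "norm \<dots> \<le> norm (infsum w (SSYT l - I)) + norm (of_nat d / fact n * infsum w (F - I))"
    by (rule norm_triangle_ineq4)
  also have "\<dots> \<le> B + real d / fact n * B"
    using bound[OF SF] bound[of F]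
    by (intro add_mono) (auto simp: norm_mult norm_divide intro!: mult_left_mono divide_right_mono)
  finally show ?thesis
    by (simp add: B_def n_def d_def algebra_simps)
qed

section \<open>Limits of geometric sums and of the exponents\<close>

lemma has_sum_odd_powers:
  fixes z :: "'a::{real_normed_field, banach}"
  assumes "z \<noteq> 0" "norm z < 1"
  shows "((\<lambda>i. z powi (2 * int i - 1)) has_sum z / (1 - z\<^sup>2)) {1..}"
proof -
  have "norm (z\<^sup>2) < 1"
    using assms by (simp add: norm_power power_less_one_iff)
  \<comment> \<open>The odd powers are a geometric series in \<open>z\<^sup>2\<close>, started at
    index 1 and divided by \<open>z\<close>.\<close>
  then have "((\<lambda>i. (z\<^sup>2) ^ i / z) has_sum (z\<^sup>2 / (1 - z\<^sup>2) / z)) {1..}"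
    using has_sum_geometric_from_1 has_sum_divide_const by blast
  also have "(\<lambda>i. (z\<^sup>2) ^ i / z) = (\<lambda>i. z powi (2 * int i - 1))"
  proof
    fix i
    have "z powi (2 * int i) = (z\<^sup>2) ^ i"
      by (metis of_nat_mult of_nat_numeral power_int_of_nat power_mult)
    then show "(z\<^sup>2) ^ i / z = z powi (2 * int i - 1)"
      using assms by (simp add: power_int_diff)
  qed
  also have "z\<^sup>2 / (1 - z\<^sup>2) / z = z / (1 - z\<^sup>2)"
    using assms by (simp add: power2_eq_square)
  finally show ?thesis .
qed

lemma tendsto_exp_minus_1_over:
  fixes c :: "'a::{real_normed_field, banach}"
  shows "((\<lambda>R. (exp (of_real R * c) - 1) / of_real R) \<longlongrightarrow> c) (at_right 0)"
\<comment> \<open>The standard limit of \<open>(exp z - 1) / z\<close> needs a nonzero argument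
  tending to 0. The case \<open>c = 0\<close> does arise later, for rows with
  \<open>l i = i\<close>.\<close>
proof (cases "c = 0")
  case False
  have "filterlim (\<lambda>R. of_real R * c) (at 0) (at_right 0)"
  proof (rule filterlim_atI)
    have "((\<lambda>R. of_real R * c) \<longlongrightarrow> of_real 0 * c) (at_right 0)"
      by (intro tendsto_intros)
    then show "((\<lambda>R. of_real R * c) \<longlongrightarrow> 0) (at_right 0)" by simp
    show "\<forall>\<^sub>F R in at_right 0. of_real R * c \<noteq> 0"
      using False eventually_at_right_less[of 0] by (auto elim: eventually_mono)
  qed
  from filterlim_compose[OF lim_exp_minus_1 this]
  have "((\<lambda>R. c * ((exp (of_real R * c) - 1) / (of_real R * c))) \<longlongrightarrow> c * 1) (at_right 0)"
    by (intro tendsto_intros)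
  then show ?thesis
    using False by simp
qed simp

text \<open>The numerator tends to 1, and \<open>1 - exp (- R c)\<close> behaves like
  \<open>R c\<close>. It is used with \<open>c = hbar\<close> for the complex sum, and with
  \<open>Re hbar\<close> and \<open>2 * Re hbar\<close> for the sums of norms and of squared
  norms.\<close>

lemma tendsto_odd_power_sum:
  fixes c :: "'a::{real_normed_field, banach}"
  assumes "c \<noteq> 0"
  shows "((\<lambda>R. of_real R * (exp (- (of_real R * c) / 2) / (1 - (exp (- (of_real R * c) / 2))\<^sup>2)))
    \<longlongrightarrow> 1 / c) (at_right 0)"
proof -
  have "((\<lambda>R. exp (- (of_real R * c) / 2)) \<longlongrightarrow> exp (- (of_real 0 * c) / 2)) (at_right 0)"
    by (intro tendsto_intros) auto
  \<comment> \<open>The factor \<open>R\<close> is moved below the fraction bar, which turns the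
    denominator into minus a difference quotient of \<open>exp\<close>.\<close>
  then have "((\<lambda>R. exp (- (of_real R * c) / 2) / - ((exp (of_real R * - c) - 1) / of_real R))
    \<longlongrightarrow> 1 / - (- c)) (at_right 0)"
    using assms by (intro tendsto_intros tendsto_exp_minus_1_over) auto
  moreover have "exp (- (of_real R * c) / 2) / - ((exp (of_real R * - c) - 1) / of_real R) =
    of_real R * (exp (- (of_real R * c) / 2) / (1 - (exp (- (of_real R * c) / 2))\<^sup>2))" for R
  proof -
    have "exp (of_real R * - c) = (exp (- (of_real R * c) / 2))\<^sup>2"
      by (simp add: exp_double[symmetric])
    moreover have "a / - ((b - 1) / r) = r * (a / (1 - b))" for a b r :: 'a
      by (metis divide_divide_eq_right minus_diff_eq minus_divide_left mult.commute times_divide_eq_right)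
    ultimately show ?thesis
      by simp
  qed
  ultimately show ?thesis by simp
qed

text \<open>The sum over \<open>j\<close> is the coefficient of \<open>T k\<close> in the
  transformed exponent: among \<open>t 1, t 2, ...\<close> exactly those with
  \<open>j \<le> k\<close> contain it.\<close>

lemma tendsto_exponent_coeff:
  fixes hbar :: complex
  assumes h: "hbar \<noteq> 0" and l: "l \<in> Partitions" and k: "k \<ge> 1"
  shows "((\<lambda>R. \<Sum>j=1..k. of_nat (k choose j) * (-1) ^ (k - j) / (- (of_real R * hbar)) ^ k *
      phi ((exp (- (of_real R * hbar) / 2))\<^sup>2) j l) \<longlongrightarrow> phi4D k l) (at_right 0)"
proof -
  define q where "q R = (exp (- (of_real R * hbar) / 2))\<^sup>2" for R
  have q0: "q R \<noteq> 0" for R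
    by (simp add: q_def)
  have q_powi: "q R powi m = exp (of_real R * - (of_int m * hbar))" for R m
  proof -
    have "q R = exp (- (of_real R * hbar))"
      by (simp add: q_def exp_double[symmetric])
    then show ?thesis
      by (simp add: exp_power_int mult_ac)
  qed
  define N where "N = {i. l i \<noteq> 0}"
  have N: "finite N" "i \<notin> N \<Longrightarrow> l i = 0" for i
    using l by (auto simp: N_def Partitions_def)
  have powi_mult: "q R powi (int j * m) = (q R powi m) ^ j" for R j m
    by (metis mult.commute power_int_mult power_int_of_nat)
  have phi: "phi (q R) j l = (\<Sum>i\<in>N. (q R powi (int (l i) - int i)) ^ j - (q R powi (- int i)) ^ j)" for R j
    unfolding phi_def powi_mult by (subst suminf_finite[OF N(1)]) (simp_all add: N(2))
  have phi4D: "phi4D k l = (\<Sum>i\<in>N. of_int (int (l i) - int i) ^ k - of_int (- int i) ^ k)"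
    unfolding phi4D_def by (subst suminf_finite[OF N(1)]) (auto simp: N)
  \<comment> \<open>The binomial theorem would start at \<open>j = 0\<close>, but that term cancels
    because \<open>a ^ 0 - b ^ 0 = 0\<close>. This is why couplings from index 1 on suffice.\<close>
  have binom: "(\<Sum>j=1..k. of_nat (k choose j) * (-1) ^ (k - j) * (a ^ j - b ^ j)) = (a - 1) ^ k - (b - 1) ^ k"
    for a b :: complex
  proof -
    have "(a - 1) ^ k - (b - 1) ^ k = (\<Sum>j\<le>k. of_nat (k choose j) * (-1) ^ (k - j) * (a ^ j - b ^ j))"
      using binomial_ring[of a "-1" k] binomial_ring[of b "-1" k]
      by (simp add: sum_subtractf[symmetric] algebra_simps)
    also have "\<dots> = (\<Sum>j=1..k. of_nat (k choose j) * (-1) ^ (k - j) * (a ^ j - b ^ j))"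
      by (rule sum.mono_neutral_right) (auto simp: Suc_le_eq)
    finally show ?thesis ..
  qed
  have pt: "((\<lambda>R. (q R powi m - 1) / - (of_real R * hbar)) \<longlongrightarrow> of_int m) (at_right 0)" for m
  proof -
    have "((\<lambda>R. (exp (of_real R * - (of_int m * hbar)) - 1) / of_real R / - hbar)
        \<longlongrightarrow> - (of_int m * hbar) / - hbar) (at_right 0)"
      using h by (intro tendsto_intros tendsto_exp_minus_1_over) auto
    then show ?thesis
      using h by (simp add: q_powi)
  qed
  have "((\<lambda>R. \<Sum>i\<in>N. ((q R powi (int (l i) - int i) - 1) / - (of_real R * hbar)) ^ k -
      ((q R powi (- int i) - 1) / - (of_real R * hbar)) ^ k) \<longlongrightarrow> phi4D k l) (at_right 0)"
    unfolding phi4D by (intro tendsto_intros pt)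
  also have "(\<lambda>R. \<Sum>i\<in>N. ((q R powi (int (l i) - int i) - 1) / - (of_real R * hbar)) ^ k -
      ((q R powi (- int i) - 1) / - (of_real R * hbar)) ^ k) =
    (\<lambda>R. \<Sum>j=1..k. of_nat (k choose j) * (-1) ^ (k - j) / (- (of_real R * hbar)) ^ k * phi (q R) j l)"
  proof
    fix R :: real
    have "(\<Sum>j=1..k. of_nat (k choose j) * (-1) ^ (k - j) / (- (of_real R * hbar)) ^ k * phi (q R) j l) =
      (\<Sum>j=1..k. \<Sum>i\<in>N. of_nat (k choose j) * (-1) ^ (k - j) *
        ((q R powi (int (l i) - int i)) ^ j - (q R powi (- int i)) ^ j)) / (- (of_real R * hbar)) ^ k"
      by (simp add: phi sum_distrib_left sum_divide_distrib)
    also have "\<dots> = (\<Sum>i\<in>N. ((q R powi (int (l i) - int i) - 1) ^ k - (q R powi (- int i) - 1) ^ k)) /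
        (- (of_real R * hbar)) ^ k"
      by (subst sum.swap) (simp only: binom)
    finally show "(\<Sum>i\<in>N. ((q R powi (int (l i) - int i) - 1) / - (of_real R * hbar)) ^ k -
      ((q R powi (- int i) - 1) / - (of_real R * hbar)) ^ k) =
      (\<Sum>j=1..k. of_nat (k choose j) * (-1) ^ (k - j) / (- (of_real R * hbar)) ^ k * phi (q R) j l)"
      by (simp only: power_divide sum_divide_distrib diff_divide_distrib[of "a ^ k" "b ^ k" for a b])
  qed
  finally show ?thesis
    by (simp add: q_def)
qed

section \<open>Coefficientwise limits of formal power series\<close>

lemma mps_coeff_sum_eq:
  assumes "finite J" "J \<subseteq> I" "\<And>i. i \<in> I - J \<Longrightarrow> mps_coeff (f i) M = 0"
  shows "mps_coeff (mps_sum f I) M = (\<Sum>i\<in>J. mps_coeff (f i) M)"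
  unfolding mps_sum_def mps_coeff_Abs
  by (rule sum.mono_neutral_left) (use assms in auto)

lemma mps_const_power: "(mps_const c :: ('v, 'a::comm_ring_1) mps) ^ n = mps_const (c ^ n)"
proof (induction n)
  case 0
  show ?case
    by (rule mps_eqI) (simp add: mps_const_def one_mps_def)
next
  case (Suc n)
  then show ?case
    by (auto intro!: mps_eqI simp: mps_const_def[of "c ^ n"] mps_const_def[of "c * c ^ n"])
qed

definition mps_tendsto ::
  "('x \<Rightarrow> ('v, 'a::{topological_space, comm_ring_1}) mps) \<Rightarrow> ('v, 'a) mps \<Rightarrow> 'x filter \<Rightarrow> bool" where
  "mps_tendsto f g F \<longleftrightarrow> (\<forall>M. ((\<lambda>x. mps_coeff (f x) M) \<longlongrightarrow> mps_coeff g M) F)"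

lemma mps_tendsto_times:
  fixes f f' :: "'x \<Rightarrow> ('v, complex) mps"
  assumes "mps_tendsto f g F" "mps_tendsto f' g' F"
  shows "mps_tendsto (\<lambda>x. f x * f' x) (g * g') F"
  using assms unfolding mps_tendsto_def mps_coeff_times by (auto intro!: tendsto_intros)

lemma mps_tendsto_power:
  fixes f :: "'x \<Rightarrow> ('v, complex) mps"
  assumes "mps_tendsto f g F"
  shows "mps_tendsto (\<lambda>x. f x ^ n) (g ^ n) F"
proof (induction n)
  case 0
  then show ?case by (simp add: mps_tendsto_def)
next
  case (Suc n)
  then show ?case using assms by (simp add: mps_tendsto_times)
qed

text \<open>Without constant term, \<open>f ^ n\<close> has no monomials of size below
  \<open>n\<close>. The resulting range of summation depends only on \<open>M\<close>, so a limit
  can be taken term by term.\<close>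

lemma mps_coeff_exp:
  assumes "mps_coeff f {#} = 0"
  shows "mps_coeff (mps_exp f) M = (\<Sum>n\<le>size M. 1 / fact n * mps_coeff (f ^ n) M)"
  unfolding mps_exp_def
  using mps_coeff_power_times_eq_0[OF assms, of M _ 1]
  by (subst mps_coeff_sum_eq[of "{..size M}"]) auto

lemma mps_tendsto_exp:
  assumes "mps_tendsto f g F" "\<And>x. mps_coeff (f x) {#} = 0" "mps_coeff g {#} = 0"
  shows "mps_tendsto (\<lambda>x. mps_exp (f x)) (mps_exp g) F"
  using mps_tendsto_power[OF assms(1)]
  unfolding mps_tendsto_def by (auto simp: mps_coeff_exp assms(2,3) intro!: tendsto_intros)

lemma mps_coeff_t_of_T:
  "mps_coeff (t_of_T R hbar Tvars j) {#Tvar k#} =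
    (if j \<le> k then of_nat (k choose j) * (-1) ^ (k - j) / (- (of_real R * hbar)) ^ k else 0)"
  unfolding t_of_T_def
  by (subst mps_coeff_sum_eq[of "{j..} \<inter> {k}"]) (auto simp: mps_coeff_Tvars)

lemma mps_tendsto_exponent:
  assumes h: "hbar \<noteq> 0" and l: "l \<in> Partitions"
  shows "mps_tendsto
    (\<lambda>R. mps_sum (\<lambda>k. t_of_T R hbar Tvars k * mps_const (phi ((exp (- (of_real R * hbar) / 2))\<^sup>2) k l)) {1..})
    (mps_sum (\<lambda>k. Tvars k * mps_const (phi4D k l)) {1..}) (at_right 0)"
  unfolding mps_tendsto_def
proof
  fix M
  show "((\<lambda>R. mps_coeff (mps_sum (\<lambda>k. t_of_T R hbar Tvars k *
      mps_const (phi ((exp (- (of_real R * hbar) / 2))\<^sup>2) k l)) {1..}) M)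
    \<longlongrightarrow> mps_coeff (mps_sum (\<lambda>k. Tvars k * mps_const (phi4D k l)) {1..}) M) (at_right 0)"
  \<comment> \<open>Both exponents are linear in the couplings. The variable \<open>Tvar 0\<close>
    exists in the type but falls under the second case: \<open>t j\<close> involves only indices
    \<open>k \<ge> j\<close>, and \<open>j\<close> starts at 1.\<close>
  proof (cases "\<exists>k\<ge>1. M = {#Tvar k#}")
    case True
    then obtain k where k: "k \<ge> 1" "M = {#Tvar k#}"
      by blast
    have "mps_coeff (mps_sum (\<lambda>k. Tvars k * mps_const (phi4D k l)) {1..}) M = phi4D k l"
      using k by (subst mps_coeff_sum_eq[of "{k}"]) (auto simp: mps_coeff_Tvars)
    moreover have "mps_coeff (mps_sum (\<lambda>k. t_of_T R hbar Tvars k * mps_const (c k)) {1..}) M =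
      (\<Sum>j=1..k. of_nat (k choose j) * (-1) ^ (k - j) / (- (of_real R * hbar)) ^ k * c j)" for R c
      using k by (subst mps_coeff_sum_eq[of "{1..k}"]) (auto simp: mps_coeff_t_of_T)
    ultimately show ?thesis
      using tendsto_exponent_coeff[OF h l k(1)] by simp
  next
    case False
    have "mps_coeff (mps_sum (\<lambda>k. Tvars k * mps_const (phi4D k l)) {1..}) M = 0"
      using False by (subst mps_coeff_sum_eq[of "{}"]) (auto simp: mps_coeff_Tvars)
    moreover have "mps_coeff (mps_sum (\<lambda>k. t_of_T R hbar Tvars k * mps_const (c k)) {1..}) M = 0" for R c
    proof (subst mps_coeff_sum_eq[of "{}"])
      fix j :: nat assume "j \<in> {1..} - {}"
      then have "\<not> (\<exists>k\<ge>j. M = {#Tvar k#})"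
        using False by (auto dest: order_trans)
      then have "mps_coeff (t_of_T R hbar Tvars j) M = 0"
        using mps_coeff_t_of_T_nonzero by blast
      then show "mps_coeff (t_of_T R hbar Tvars j * mps_const (c j)) M = 0"
        by simp
    qed auto
    ultimately show ?thesis by simp
  qed
qed

section \<open>The limit of the partition functions\<close>

lemma mps_coeff_partition_sum:
  assumes "mps_coeff Q {#} = 0"
  shows "mps_coeff (mps_sum (\<lambda>l. mps_const (c l) * Q ^ psize l * g l) Partitions) M =
    (\<Sum>l | l \<in> Partitions \<and> psize l \<le> size M. c l * mps_coeff (Q ^ psize l * g l) M)"
  \<comment> \<open>Since \<open>Q\<close> has no constant term, only partitions with
    \<open>psize l \<le> size M\<close> contribute, a finite set independent of the coefficients
    \<open>c\<close> and \<open>g\<close>.\<close>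
  using finite_partitions_le[of "size M"] mps_coeff_power_times_eq_0[OF assms]
  by (subst mps_coeff_sum_eq[of "{l \<in> Partitions. psize l \<le> size M}"]) (auto simp: mult.assoc)

text \<open>By \<open>schur_approximation\<close> the main term is governed by
  \<open>R * S (p R)\<close>, which tends to \<open>1 / hbar\<close>. In the error each sum takes up
  one factor \<open>R\<close>; an error term has \<open>n - 1\<close> sums, so one factor
  \<open>R\<close> is left over.\<close>

lemma tendsto_schur_rho:
  fixes hbar :: complex
  assumes h: "Re hbar > 0" and l: "l \<in> Partitions"
  shows "((\<lambda>R. of_real R ^ psize l * schur_rho (exp (- (of_real R * hbar) / 2)) l)
    \<longlongrightarrow> of_nat (dim_part l) / fact (psize l) * (1 / hbar) ^ psize l) (at_right 0)"
proof -
  define n where "n = psize l"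
  define d where "d = dim_part l"
  \<comment> \<open>\<open>S\<close> at \<open>p R\<close> is the sum of the Schur arguments. Its
    real analogue \<open>T\<close> gives the sum of their norms at \<open>r R\<close> and of their
    squared norms at \<open>(r R)\<^sup>2\<close>.\<close>
  define S where "S z = z / (1 - z\<^sup>2)" for z :: complex
  define T where "T z = z / (1 - z\<^sup>2)" for z :: real
  define p where "p R = exp (- (of_real R * hbar) / 2)" for R
  define r where "r R = exp (- (R * Re hbar) / 2)" for R :: real
  define C where "C = (real d / fact n + 1) * real (n * (n - 1))"
  have S_lim: "((\<lambda>R. of_real R * S (p R)) \<longlongrightarrow> 1 / hbar) (at_right 0)"
    unfolding S_def p_def by (rule tendsto_odd_power_sum) (use h in auto)
  have T_lim: "((\<lambda>R. R * T (r R)) \<longlongrightarrow> 1 / Re hbar) (at_right 0)"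
    using tendsto_odd_power_sum[of "Re hbar"] h by (simp add: T_def r_def)
  have T2_lim: "((\<lambda>R. R * T ((r R)\<^sup>2)) \<longlongrightarrow> 1 / (2 * Re hbar)) (at_right 0)"
  proof -
    have "(r R)\<^sup>2 = exp (- (R * (2 * Re hbar)) / 2)" for R
      by (simp add: r_def exp_double[symmetric])
    then show ?thesis
      using tendsto_odd_power_sum[of "2 * Re hbar"] h by (simp add: T_def)
  qed
  have bound: "norm (of_real R ^ n * schur_rho (p R) l - of_nat d / fact n * (of_real R * S (p R)) ^ n) \<le>
      C * (R * (R * T ((r R)\<^sup>2)) * (R * T (r R)) ^ (n - 2))" if R: "R > 0" for R
  proof -
    define x where "x i = p R powi (2 * int i - 1)" for i
    have norm_p: "norm (p R) = r R"
      by (simp add: p_def r_def norm_exp_eq_Re)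
    have p: "p R \<noteq> 0" "norm (p R) < 1" and r: "r R \<noteq> 0" "norm (r R) < 1" and r2: "(r R)\<^sup>2 \<noteq> 0" "norm ((r R)\<^sup>2) < 1"
      using R h by (auto simp: norm_p p_def) (auto simp: r_def power_less_one_iff)
    have norm_x: "norm (x i) = r R powi (2 * int i - 1)" for i
      by (simp add: x_def norm_power_int norm_p)
    have norm_x2: "(norm (x i))\<^sup>2 = (r R)\<^sup>2 powi (2 * int i - 1)" for i
      unfolding norm_x by (metis power_int_mult power_int_of_nat mult.commute)
    have x_sum: "((\<lambda>i. x i) has_sum S (p R)) {1..}"
      unfolding x_def S_def by (rule has_sum_odd_powers[OF p])
    have nx_sum: "((\<lambda>i. norm (x i)) has_sum T (r R)) {1..}"
      unfolding norm_x T_def by (rule has_sum_odd_powers[OF r])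
    have nx2_sum: "((\<lambda>i. (norm (x i))\<^sup>2) has_sum T ((r R)\<^sup>2)) {1..}"
      unfolding norm_x2 T_def by (rule has_sum_odd_powers[OF r2])
    have "norm (schur l x - of_nat d / fact n * S (p R) ^ n) \<le>
        (real d / fact n + 1) * (real (n * (n - 1)) * T ((r R)\<^sup>2) * T (r R) ^ (n - 2))"
      using schur_approximation[OF l has_sum_imp_summable[OF nx_sum]]
      unfolding infsumI[OF x_sum] infsumI[OF nx_sum] infsumI[OF nx2_sum] d_def n_def .
    then have "R ^ n * norm (schur l x - of_nat d / fact n * S (p R) ^ n) \<le>
        R ^ n * (C * (T ((r R)\<^sup>2) * T (r R) ^ (n - 2)))"
      using R by (intro mult_left_mono) (simp_all add: C_def mult.assoc)
    also have "R ^ n * norm (schur l x - of_nat d / fact n * S (p R) ^ n) =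
        norm (of_real R ^ n * (schur l x - of_nat d / fact n * S (p R) ^ n))"
      using R by (simp add: norm_mult norm_power)
    also have "of_real R ^ n * (schur l x - of_nat d / fact n * S (p R) ^ n) =
        of_real R ^ n * schur_rho (p R) l - of_nat d / fact n * (of_real R * S (p R)) ^ n"
      by (simp add: schur_rho_def x_def[abs_def] power_mult_distrib algebra_simps)
    also have "R ^ n * (C * (T ((r R)\<^sup>2) * T (r R) ^ (n - 2))) =
        C * (R * (R * T ((r R)\<^sup>2)) * (R * T (r R)) ^ (n - 2))"
    \<comment> \<open>Distributing \<open>R ^ n\<close> needs \<open>n \<ge> 2\<close>; below that,
      \<open>n - 2\<close> is truncated to 0, but both sides vanish because \<open>C\<close>
      contains \<open>n * (n - 1)\<close>.\<close>
    proof (cases "n \<ge> 2")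
      case True
      then have "R ^ n = R * R * R ^ (n - 2)"
        by (metis le_add_diff_inverse power2_eq_square power_add)
      then show ?thesis
        by (simp add: power_mult_distrib)
    next
      case False
      then have "C = 0"
        by (auto simp: C_def)
      then show ?thesis
        by simp
    qed
    finally show ?thesis .
  qed
  \<comment> \<open>The leading \<open>R\<close> tends to 0 while the remaining factors have finite
    limits.\<close>
  have "((\<lambda>R. C * (R * (R * T ((r R)\<^sup>2)) * (R * T (r R)) ^ (n - 2))) \<longlongrightarrow>
      C * (0 * (1 / (2 * Re hbar)) * (1 / Re hbar) ^ (n - 2))) (at_right 0)"
    by (intro tendsto_intros T_lim T2_lim)
  then have majorant: "((\<lambda>R. C * (R * (R * T ((r R)\<^sup>2)) * (R * T (r R)) ^ (n - 2))) \<longlongrightarrow> 0) (at_right 0)"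
    by simp
  have "((\<lambda>R. of_real R ^ n * schur_rho (p R) l - of_nat d / fact n * (of_real R * S (p R)) ^ n) \<longlongrightarrow> 0) (at_right 0)"
    by (rule Lim_null_comparison[OF eventually_mono[OF eventually_at_right_less] majorant]) (rule bound)
  moreover have "((\<lambda>R. of_nat d / fact n * (of_real R * S (p R)) ^ n) \<longlongrightarrow>
      of_nat d / fact n * (1 / hbar) ^ n) (at_right 0)"
    by (intro tendsto_intros S_lim)
  ultimately have "((\<lambda>R. of_real R ^ n * schur_rho (p R) l) \<longlongrightarrow> 0 + of_nat d / fact n * (1 / hbar) ^ n) (at_right 0)"
    using tendsto_add by fastforce
  then show ?thesis
    by (simp only: n_def d_def p_def add_0_left)
qed

theorem theorem6:
  fixes hbar :: complex
  assumes "Re hbar > 0"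
  shows "\<forall>M. ((\<lambda>R::real.
      mps_coeff
        (Z (exp (- (of_real R * hbar) / 2))
           (mps_const ((of_real R)\<^sup>2) * L2var)
           (t_of_T R hbar Tvars)) M)
      \<longlongrightarrow> mps_coeff (Z4D hbar L2var Tvars) M) (at_right 0)"
proof
  fix M :: "coupling multiset"
  have h: "hbar \<noteq> 0"
    using assms by auto
  define p where "p R = exp (- (of_real R * hbar) / 2)" for R
  define X where "X R l = mps_sum (\<lambda>k. t_of_T R hbar Tvars k * mps_const (phi ((p R)\<^sup>2) k l)) {1..}" for R l
  define Y where "Y l = mps_sum (\<lambda>k. Tvars k * mps_const (phi4D k l)) {1..}" for l
  define P where "P = {l \<in> Partitions. psize l \<le> size M}"
  have scale: "(mps_const c * f) ^ n * g = mps_const (c ^ n) * (f ^ n * g)"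
    for c n and f g :: "(coupling, complex) mps"
    by (simp add: power_mult_distrib mps_const_power mult.assoc)
  \<comment> \<open>The choice \<open>Q = (R \<Lambda>)^2\<close> provides
    \<open>R ^ (2 * psize l)\<close>, exactly the scaling that the squared Schur value needs for a
    finite limit.\<close>
  have "mps_coeff (Z (p R) (mps_const ((of_real R)\<^sup>2) * L2var) (t_of_T R hbar Tvars)) M =
      (\<Sum>l\<in>P. (of_real R ^ psize l * schur_rho (p R) l)\<^sup>2 * mps_coeff (L2var ^ psize l * mps_exp (X R l)) M)" for R
    unfolding Z_def P_def X_def
    by (subst mps_coeff_partition_sum[OF mps_coeff_L2var_0])
      (simp only: scale mps_coeff_const_times, simp add: power_mult_distrib mult_ac flip: power_mult)
  moreover have "mps_coeff (Z4D hbar L2var Tvars) M =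
      (\<Sum>l\<in>P. (of_nat (dim_part l) / fact (psize l) * (1 / hbar) ^ psize l)\<^sup>2 *
        mps_coeff (L2var ^ psize l * mps_exp (Y l)) M)"
    unfolding Z4D_def P_def Y_def
    by (subst mps_coeff_partition_sum[OF mps_coeff_L2var_0])
      (simp only: scale mps_coeff_const_times, simp add: power_mult_distrib power_divide mult_ac flip: power_mult)
  \<comment> \<open>Both exponents lack a constant term, so the limit passes through
    \<open>mps_exp\<close>; the power of \<open>L2var\<close> does not depend on
    \<open>R\<close>.\<close>
  moreover have lim: "((\<lambda>R. mps_coeff (L2var ^ psize l * mps_exp (X R l)) M) \<longlongrightarrow>
      mps_coeff (L2var ^ psize l * mps_exp (Y l)) M) (at_right 0)" if "l \<in> P" for l
  proof -
    have "mps_tendsto (\<lambda>R. X R l) (Y l) (at_right 0)"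
      using mps_tendsto_exponent[OF h, of l] that by (simp add: X_def Y_def p_def P_def)
    then have exp_lim: "mps_tendsto (\<lambda>R. mps_exp (X R l)) (mps_exp (Y l)) (at_right 0)"
      by (rule mps_tendsto_exp) (simp_all add: X_def Y_def mps_coeff_exponent_0)
    have "mps_tendsto (\<lambda>R. L2var ^ psize l) (L2var ^ psize l) (at_right (0::real))"
      by (simp add: mps_tendsto_def)
    from mps_tendsto_times[OF this exp_lim] show ?thesis
      by (simp add: mps_tendsto_def)
  qed
  ultimately show "((\<lambda>R. mps_coeff
        (Z (exp (- (of_real R * hbar) / 2)) (mps_const ((of_real R)\<^sup>2) * L2var) (t_of_T R hbar Tvars)) M)
      \<longlongrightarrow> mps_coeff (Z4D hbar L2var Tvars) M) (at_right 0)"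
    unfolding p_def[symmetric]
  proof (simp only:, intro tendsto_sum)
    fix l assume l: "l \<in> P"
    then show "((\<lambda>R. (of_real R ^ psize l * schur_rho (p R) l)\<^sup>2 *
        mps_coeff (L2var ^ psize l * mps_exp (X R l)) M) \<longlongrightarrow>
      (of_nat (dim_part l) / fact (psize l) * (1 / hbar) ^ psize l)\<^sup>2 *
        mps_coeff (L2var ^ psize l * mps_exp (Y l)) M) (at_right 0)"
      using tendsto_schur_rho[OF assms, of l, folded p_def]
      by (intro tendsto_mult[OF tendsto_power lim]) (simp_all add: P_def)
  qed
qed

end
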